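(* Let $q$ be a prime power, let $n,l\ge 1$, $r,t\ge 0$ be integers with $n-r-l\ge 1$, and let $u\le n$ satisfy $\lfloor\frac{q-1}{2}\rfloor+1\le u\le\lfloor\frac{q-1}{2}\rfloor+d_0-2$. Let $\boldsymbol{H}_0\in\mathbb{F}_q^{l\times n}$ be a systematic parity-check matrix of an $[n,n-l,d_0]_q$ linear code $\mathcal{C}_0$ (so $d_0\ge u-\lfloor\frac{q-1}{2}\rfloor+2$). Let $\mathcal{C}$ be an $[n,k,d]_q$ linear code with $k=n-r$ and $d\ge 2t+1$, containing the dual code $\mathcal{C}_0^\perp$ (generated by $\boldsymbol{H}_0$) as a subcode, and having a $k\times n$ generator matrix $$\boldsymbol{G}=\begin{bmatrix}\boldsymbol{G}_1\\ \boldsymbol{H}_0\end{bmatrix},\qquad \boldsymbol{G}_1=\begin{bmatrix}\boldsymbol{0}_{(n-r-l)\times l} & \boldsymbol{I}_{n-r-l} & \boldsymbol{P}\end{bmatrix},\quad \boldsymbol{P}\in\mathbb{F}_q^{(n-r-l)\times r}.$$ Consider the following coding scheme. Encoder: given a set $\phi\subseteq\{0,\dots,n-1\}$ with $|\phi|=u$ and a message $\boldsymbol{m}\in\mathbb{F}_q^{n-r-l}$, put $\boldsymbol{w}=\boldsymbol{m}\boldsymbol{G}_1$, find $\boldsymbol{z}\in\mathbb{F}_q^{l}$ such that $(\boldsymbol{w}+\boldsymbol{z}\boldsymbol{H}_0)_i\in\mathbb{F}_q\setminus\{0,-1\}$ for all $i\in\phi$, and output $\boldsymbol{c}=\boldsymbol{w}+\boldsymbol{z}\boldsymbol{H}_0$.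 Decoder: given $\boldsymbol{y}=\boldsymbol{c}+\boldsymbol{e}$, decode $\boldsymbol{y}$ in $\mathcal{C}$ to the nearest codeword $\hat{\boldsymbol{c}}$, and output the unique $\hat{\boldsymbol{m}}$ with $\hat{\boldsymbol{c}}=\hat{\boldsymbol{m}}\boldsymbol{G}_1+\hat{\boldsymbol{z}}\boldsymbol{H}_0$ for some $\hat{\boldsymbol{z}}\in\mathbb{F}_q^{l}$. Then the encoder always succeeds (such a $\boldsymbol{z}$ always exists), and the scheme is an $(n,q^{n-r-l})_q$ $(u,t)$-PDMC.
   Context: Vectors are row vectors indexed by $\{0,\dots,n-1\}$. All arithmetic is in the finite field $\mathbb{F}_q$; the element written $q-1$ in the level notation is $-1\in\mathbb{F}_q$. An $[n,k,d]_q$ code is a $k$-dimensional linear subspace of $\mathbb{F}_q^n$ with minimum Hamming distance $d$. A systematic parity-check matrix is one of the form $[\boldsymbol{I}_l\mid\ast]$. A cell is partially defective at level $1$ if it can store every value of $\mathbb{F}_q$ except $0$. Admissible error vectors are $\boldsymbol{e}\in\{0,1\}^n\subseteq\mathbb{F}_q^n$ of Hamming weight at most $t$; errors may occur at any position, including the partially defective positions. An $(n,M)_q$ $(u,t)$-PDMC (code for partially defective memory cells) is a pair (encoder $\mathcal{E}$, decoder $\mathcal{D}$) with a message set $\mathcal{M}$ of size $M$ such that: $\mathcal{E}$ takes a set $\phi\subseteq\{0,\dots,n-1\}$ of $u$ positions (cells partially defective at level $1$) and a message $\boldsymbol{m}\in\mathcal{M}$, and outputs $\boldsymbol{c}\in\mathbb{F}_q^n$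 such that for every admissible error vector $\boldsymbol{e}$ one has $c_i+e_i\neq 0$ for all $i\in\phi$; and $\mathcal{D}$, which is given only $\boldsymbol{c}+\boldsymbol{e}$ (not $\phi$), returns $\boldsymbol{m}$ for every admissible $\boldsymbol{e}$.
   Formalization: The formal theorem assumes q ≥ 3; for q = 2 the set F_q∖{0,−1} is empty while u ≥ 1, so no z exists and the claim as stated is false (e.g. n=3, l=2, r=t=0, u=1, C_0 the binary repetition code). *)

theory Defs
  imports
    "Jordan_Normal_Form.VS_Connect"
    "Jordan_Normal_Form.Matrix_Kernel"
    "HOL-Library.Cardinality"
begin

section \<open>Row vectors and block matrices\<close>

text \<open>
  The library treats every vector as a column vector, so the row-vector product is expressed
  through the transpose. Positions are numbered from 0.
\<close>

definition vec_mult_mat :: "'a :: comm_semiring_0 vec \<Rightarrow> 'a mat \<Rightarrow> 'a vec" (infixl \<open>\<^sub>v*\<close> 70)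
  where "v \<^sub>v* A = A\<^sup>T *\<^sub>v v"

definition append_cols :: "'a :: zero mat \<Rightarrow> 'a mat \<Rightarrow> 'a mat" (infixr \<open>@\<^sub>c\<close> 65)
  where "A @\<^sub>c B = four_block_mat A B (0\<^sub>m 0 (dim_col A)) (0\<^sub>m 0 (dim_col B))"

section \<open>Linear codes\<close>

definition hamming_dist :: "'a vec \<Rightarrow> 'a vec \<Rightarrow> nat"
  where "hamming_dist x y = card {i. i < dim_vec x \<and> x $ i \<noteq> y $ i}"

definition hamming_weight :: "'a :: zero vec \<Rightarrow> nat"
  where "hamming_weight x = card {i. i < dim_vec x \<and> x $ i \<noteq> 0}"

text \<open>Only meaningful for codes with at least two codewords, since \<open>Min {}\<close> is unspecified.\<close>

definition min_dist :: "'a vec set \<Rightarrow> nat"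
  where "min_dist C = Min {hamming_dist x y | x y. x \<in> C \<and> y \<in> C \<and> x \<noteq> y}"

definition code_dim :: "nat \<Rightarrow> 'a :: field vec set \<Rightarrow> nat"
  where "code_dim n C = vectorspace.dim class_ring (module_vec TYPE('a) n\<lparr>carrier := C\<rparr>)"

definition linear_code :: "nat \<Rightarrow> nat \<Rightarrow> nat \<Rightarrow> 'a :: {finite, field} vec set \<Rightarrow> bool"
  where "linear_code n k d C \<longleftrightarrow>
    VectorSpace.subspace class_ring C (module_vec TYPE('a) n) \<and> code_dim n C = k \<and> min_dist C = d"

abbreviation dual_code :: "nat \<Rightarrow> 'a :: field vec set \<Rightarrow> 'a vec set"
  where "dual_code n C \<equiv> vec_module.orthogonal_complement n C"

text \<open>
  In both definitions the condition on the dimension says that the rows of the matrix are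
  linearly independent.
\<close>

definition generator_matrix :: "nat \<Rightarrow> nat \<Rightarrow> 'a :: field mat \<Rightarrow> 'a vec set \<Rightarrow> bool"
  where "generator_matrix n k G C \<longleftrightarrow>
    G \<in> carrier_mat k n \<and> vec_space.row_space n G = C \<and> code_dim n C = k"

definition parity_check_matrix :: "nat \<Rightarrow> nat \<Rightarrow> 'a :: field mat \<Rightarrow> 'a vec set \<Rightarrow> bool"
  where "parity_check_matrix n l H C \<longleftrightarrow>
    H \<in> carrier_mat l n \<and> mat_kernel H = C \<and> code_dim n C + l = n"

definition systematic :: "nat \<Rightarrow> nat \<Rightarrow> 'a :: field mat \<Rightarrow> bool"
  where "systematic n l H \<longleftrightarrow> (\<exists>A \<in> carrier_mat l (n - l). H = 1\<^sub>m l @\<^sub>c A)"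

section \<open>Codes for partially defective memory cells\<close>

definition admissible_errors :: "nat \<Rightarrow> nat \<Rightarrow> 'a :: {finite, field} vec set"
  where "admissible_errors n t =
    {e \<in> carrier_vec n. (\<forall>i<n. e $ i \<in> {0, 1}) \<and> hamming_weight e \<le> t}"

definition defect_sets :: "nat \<Rightarrow> nat \<Rightarrow> nat set set"
  where "defect_sets n u = {\<phi>. \<phi> \<subseteq> {..<n} \<and> card \<phi> = u}"

text \<open>
  An \<open>(n, M)\<close> \<open>(u, t)\<close>-PDMC over the field \<open>'a\<close> with message set \<open>Msg\<close>, encoder \<open>E\<close> and
  decoder \<open>D\<close>. The decoder does not see the defective positions.
\<close>

definition PDMC :: "nat \<Rightarrow> nat \<Rightarrow> nat \<Rightarrow> nat \<Rightarrow> 'm set \<Rightarrow>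
    (nat set \<Rightarrow> 'm \<Rightarrow> 'a :: {finite, field} vec) \<Rightarrow> ('a vec \<Rightarrow> 'm) \<Rightarrow> bool"
  where "PDMC n M u t Msg E D \<longleftrightarrow>
    finite Msg \<and> card Msg = M \<and>
    (\<forall>\<phi> \<in> defect_sets n u. \<forall>m \<in> Msg.
      E \<phi> m \<in> carrier_vec n \<and>
      (\<forall>e \<in> admissible_errors n t.
        (\<forall>i \<in> \<phi>. (E \<phi> m + e) $ i \<noteq> 0) \<and> D (E \<phi> m + e) = m))"

section \<open>The coding scheme\<close>

definition masking_vec :: "'a :: {finite, field} mat \<Rightarrow> 'a mat \<Rightarrow> nat set \<Rightarrow> 'a vec \<Rightarrow> 'a vec \<Rightarrow> bool"
  where "masking_vec G1 H0 \<phi> m z \<longleftrightarrow>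
    z \<in> carrier_vec (dim_row H0) \<and>
    (\<forall>i \<in> \<phi>. (m \<^sub>v* G1 + z \<^sub>v* H0) $ i \<in> UNIV - {0, -1})"

text \<open>
  The encoder may choose any suitable \<open>z\<close>, and the decoder any nearest codeword in case of a tie,
  so both are specified by predicates.
\<close>

definition scheme_encoder :: "nat \<Rightarrow> nat \<Rightarrow> 'a :: {finite, field} mat \<Rightarrow> 'a mat \<Rightarrow>
    (nat set \<Rightarrow> 'a vec \<Rightarrow> 'a vec) \<Rightarrow> bool"
  where "scheme_encoder n u G1 H0 E \<longleftrightarrow>
    (\<forall>\<phi> \<in> defect_sets n u. \<forall>m \<in> carrier_vec (dim_row G1).
      \<exists>z. masking_vec G1 H0 \<phi> m z \<and> E \<phi> m = m \<^sub>v* G1 + z \<^sub>v* H0)"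

definition extract_message :: "'a :: {finite, field} mat \<Rightarrow> 'a mat \<Rightarrow> 'a vec \<Rightarrow> 'a vec"
  where "extract_message G1 H0 c =
    (THE m. m \<in> carrier_vec (dim_row G1) \<and>
      (\<exists>z \<in> carrier_vec (dim_row H0). c = m \<^sub>v* G1 + z \<^sub>v* H0))"

definition scheme_decoder :: "nat \<Rightarrow> 'a :: {finite, field} vec set \<Rightarrow> 'a mat \<Rightarrow> 'a mat \<Rightarrow>
    ('a vec \<Rightarrow> 'a vec) \<Rightarrow> bool"
  where "scheme_decoder n C G1 H0 D \<longleftrightarrow>
    (\<forall>y \<in> carrier_vec n.
      \<exists>c. is_arg_min (hamming_dist y) (\<lambda>c. c \<in> C) c \<and> D y = extract_message G1 H0 c)"

lemma ex_scheme_encoder: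
  assumes "\<forall>\<phi> \<in> defect_sets n u. \<forall>m \<in> carrier_vec (dim_row G1). \<exists>z. masking_vec G1 H0 \<phi> m z"
  shows "\<exists>E. scheme_encoder n u G1 H0 E"
  unfolding scheme_encoder_def using assms
  by (intro exI[of _ "\<lambda>\<phi> m. m \<^sub>v* G1 + (SOME z. masking_vec G1 H0 \<phi> m z) \<^sub>v* H0"])
    (metis someI_ex)

lemma ex_scheme_decoder:
  assumes "C \<noteq> {}"
  shows "\<exists>D. scheme_decoder n C G1 H0 D"
proof -
  have "is_arg_min (hamming_dist y) (\<lambda>c. c \<in> C) (arg_min (hamming_dist y) (\<lambda>c. c \<in> C))" for y
    using assms by (auto simp: is_arg_min_arg_min_nat)
  then show ?thesis
    by (intro exI[of _ "\<lambda>y. extract_message G1 H0 (arg_min (hamming_dist y) (\<lambda>c. c \<in> C))"])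
      (auto simp: scheme_decoder_def)
qed

end

theory Submission
  imports Defs "Berlekamp_Zassenhaus.Berlekamp_Type_Based"
begin

text \<open>
  Put \<open>s = u - (q - 1) div 2\<close>. Any \<open>s + 1 < d0\<close> columns of \<open>H0\<close> are linearly independent, so
  \<open>z \<^sub>v* H0\<close> can be prescribed arbitrarily on any \<open>s + 1\<close> positions. Give \<open>s\<close> of the defective
  positions an allowed value. On the affine space of the \<open>z\<close> that achieve this, the value at each
  of the other \<open>(q - 1) div 2\<close> defective positions is equidistributed, so each of them rules out at
  most a fraction \<open>2 / q\<close> of the space. Together they rule out less than all of it.

  Since errors only add 0 or 1, avoiding 0 and -1 keeps the stored values nonzero. Unique decoding
  in \<open>C\<close> recovers the codeword, whose first coordinates determine \<open>z\<close> and then the message.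
\<close>

section \<open>Interpolation by linear functionals\<close>

text \<open>Linear independence of the family \<open>h\<close> on \<open>T\<close> in dual form: the
  map sending \<open>z\<close> to the tuple of all \<open>h i \<bullet> z\<close> is onto. Indexing
  by \<open>i\<close> counts repeated vectors separately.\<close>

definition interpolating :: "nat \<Rightarrow> ('i \<Rightarrow> 'a :: field vec) \<Rightarrow> 'i set \<Rightarrow> bool"
  where "interpolating l h T \<longleftrightarrow> (\<forall>a. \<exists>z \<in> carrier_vec l. \<forall>i \<in> T. h i \<bullet> z = a i)"

lemma interpolatingE:
  assumes "interpolating l h T"
  obtains z where "z \<in> carrier_vec l" "\<And>i. i \<in> T \<Longrightarrow> h i \<bullet> z = a i"
  using assms unfolding interpolating_def by blast

text \<open>Induction on \<open>T\<close>. Independence supplies a vector killed by the old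
  functionals but not by the new one; adding a multiple of it to an old interpolant corrects the new
  value alone.\<close>

lemma interpolating_if_independent:
  fixes h :: "'i \<Rightarrow> 'a :: field vec"
  assumes "finite T"
    and "\<And>i. i \<in> T \<Longrightarrow> h i \<in> carrier_vec l"
    and "\<And>c. (\<And>k. k < l \<Longrightarrow> (\<Sum>i\<in>T. c i * h i $ k) = 0) \<Longrightarrow> \<forall>i\<in>T. c i = 0"
  shows "interpolating l h T"
  using assms
proof (induction T rule: finite_induct)
  case empty
  show ?case unfolding interpolating_def using zero_carrier_vec by blast
next
  case (insert j T)
  have hc: "h i \<in> carrier_vec l" if "i \<in> insert j T" for i
    using insert.prems(1) that .
  have IH: "interpolating l h T"
  proof (rule insert.IH)
    fix c assume c: "\<And>k. k < l \<Longrightarrow> (\<Sum>i\<in>T. c i * h i $ k) = 0"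
    \<comment> \<open>A relation on \<open>T\<close> becomes one on \<open>insert j T\<close> by
      giving \<open>j\<close> the coefficient 0.\<close>
    have "\<forall>i\<in>insert j T. (c(j := 0)) i = 0"
    proof (rule insert.prems(2))
      fix k assume "k < l"
      have "(\<Sum>i\<in>T. (c(j := 0)) i * h i $ k) = (\<Sum>i\<in>T. c i * h i $ k)"
        using insert.hyps by (intro sum.cong) auto
      then show "(\<Sum>i\<in>insert j T. (c(j := 0)) i * h i $ k) = 0"
        using insert.hyps c[OF \<open>k < l\<close>] by simp
    qed
    then show "\<forall>i\<in>T. c i = 0" using insert.hyps by (metis fun_upd_other insertCI)
  qed (use insert.prems in auto)
  \<comment> \<open>Otherwise \<open>h j\<close> vanishes on the common kernel of the other
    functionals, hence is a linear combination of them, contradicting independence.\<close>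
  have "\<exists>v\<in>carrier_vec l. (\<forall>i\<in>T. h i \<bullet> v = 0) \<and> h j \<bullet> v \<noteq> 0"
  proof (rule ccontr)
    assume "\<not> ?thesis"
    then have kill: "h j \<bullet> v = 0" if "v \<in> carrier_vec l" "\<And>i. i \<in> T \<Longrightarrow> h i \<bullet> v = 0" for v
      using that by blast
    \<comment> \<open>The \<open>b x\<close> form a system dual to the \<open>h i\<close> with
      \<open>i\<close> in \<open>T\<close>.\<close>
    have "\<exists>b. b \<in> carrier_vec l \<and> (\<forall>i\<in>T. h i \<bullet> b = (if i = x then 1 else 0))" for x
      by (rule interpolatingE[OF IH, of "\<lambda>i. if i = x then 1 else 0"]) blast
    then obtain b where b: "\<And>x. b x \<in> carrier_vec l"
      "\<And>x i. i \<in> T \<Longrightarrow> h i \<bullet> b x = (if i = x then 1 else 0)"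
      by metis
    \<comment> \<open>Subtracting its interpolant from a unit vector gives a vector killed by \<open>h j\<close>, which
      expresses \<open>h j\<close> through the other functionals.\<close>
    have comb: "h j $ k = (\<Sum>x\<in>T. h x $ k * (h j \<bullet> b x))" if k: "k < l" for k
    proof -
      define v where "v = vec l (\<lambda>m. unit_vec l k $ m - (\<Sum>x\<in>T. h x $ k * b x $ m))"
      have v: "h i \<bullet> v = h i $ k - (\<Sum>x\<in>T. h x $ k * (h i \<bullet> b x))" if "i \<in> insert j T" for i
      proof -
        have "h i \<bullet> v = (\<Sum>m<l. h i $ m * unit_vec l k $ m) - (\<Sum>m<l. \<Sum>x\<in>T. h i $ m * (h x $ k * b x $ m))"
          by (simp add: scalar_prod_def v_def right_diff_distrib sum_subtractf sum_distrib_left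
            lessThan_atLeast0)
        also have "(\<Sum>m<l. h i $ m * unit_vec l k $ m) = h i \<bullet> unit_vec l k"
          by (simp add: scalar_prod_def lessThan_atLeast0)
        also have "\<dots> = h i $ k"
          using k by simp
        also have "(\<Sum>m<l. \<Sum>x\<in>T. h i $ m * (h x $ k * b x $ m))
            = (\<Sum>x\<in>T. \<Sum>m<l. h i $ m * (h x $ k * b x $ m))"
          by (rule sum.swap)
        also have "\<dots> = (\<Sum>x\<in>T. h x $ k * (h i \<bullet> b x))"
          using carrier_vecD[OF b(1)]
          by (simp add: scalar_prod_def sum_distrib_left lessThan_atLeast0 mult.left_commute)
        finally show ?thesis .
      qed
      have "h i \<bullet> v = 0" if "i \<in> T" for i
        using v[of i] b(2)[of i] that insert.hyps(1) by (simp add: if_distrib cong: if_cong)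
      then have "h j \<bullet> v = 0" by (intro kill) (auto simp: v_def)
      then show ?thesis using v[of j] by simp
    qed
    \<comment> \<open>Moving \<open>h j\<close> to the other side gives a relation whose coefficient
      at \<open>j\<close> is -1, which cannot vanish.\<close>
    have "\<forall>i\<in>insert j T. (\<lambda>i. if i = j then - 1 else h j \<bullet> b i) i = 0"
    proof (rule insert.prems(2))
      fix k assume "k < l"
      have "(\<Sum>i\<in>T. (if i = j then - 1 else h j \<bullet> b i) * h i $ k) = (\<Sum>x\<in>T. h x $ k * (h j \<bullet> b x))"
        using insert.hyps by (intro sum.cong) auto
      then show "(\<Sum>i\<in>insert j T. (if i = j then - 1 else h j \<bullet> b i) * h i $ k) = 0"
        using insert.hyps comb[OF \<open>k < l\<close>] by simp
    qed
    then show False by simp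
  qed
  then obtain v where v: "v \<in> carrier_vec l" "\<And>i. i \<in> T \<Longrightarrow> h i \<bullet> v = 0" "h j \<bullet> v \<noteq> 0"
    by blast
  show ?case unfolding interpolating_def
  proof
    fix a
    obtain z where z: "z \<in> carrier_vec l" "\<And>i. i \<in> T \<Longrightarrow> h i \<bullet> z = a i"
      by (rule interpolatingE[OF IH, of a]) blast
    \<comment> \<open>The scalar is the error of \<open>z\<close> at \<open>j\<close> divided by the
      nonzero value \<open>h j \<bullet> v\<close>; on \<open>T\<close> the added term contributes
      0.\<close>
    have "h i \<bullet> (z + ((a j - h j \<bullet> z) / (h j \<bullet> v)) \<cdot>\<^sub>v v) = a i" if "i \<in> insert j T" for i
      using that v z hc[OF that]
      by (cases "i = j") (simp_all add: scalar_prod_add_distrib[where n = l])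
    then show "\<exists>z\<in>carrier_vec l. \<forall>i\<in>insert j T. h i \<bullet> z = a i"
      using v(1) z(1) by (meson add_carrier_vec smult_carrier_vec)
  qed
qed

section \<open>Masking\<close>

text \<open>Take \<open>v\<close> with \<open>h j \<bullet> v = 1\<close> and
  \<open>h i \<bullet> v = 0\<close> on \<open>S\<close>. Translation by multiples of
  \<open>v\<close> preserves \<open>Z\<close> and carries any fibre injectively into any
  other.\<close>

lemma card_fiber_of_interpolating:
  fixes h :: "'i \<Rightarrow> 'a :: {finite, field} vec" and a :: "'i \<Rightarrow> 'a" and w :: 'a
  assumes "interpolating l h (insert j S)" and "j \<notin> S"
    and h: "\<And>i. i \<in> insert j S \<Longrightarrow> h i \<in> carrier_vec l"
  defines "Z \<equiv> {z \<in> carrier_vec l. \<forall>i\<in>S. h i \<bullet> z = a i}"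
  shows "CARD('a) * card {z \<in> Z. w + h j \<bullet> z = b} = card Z"
proof -
  let ?F = "\<lambda>b. {z \<in> Z. w + h j \<bullet> z = b}"
  have fin: "finite Z" unfolding Z_def by simp
  obtain v where v: "v \<in> carrier_vec l" "\<And>i. i \<in> insert j S \<Longrightarrow> h i \<bullet> v = (if i = j then 1 else 0)"
    by (rule interpolatingE[OF assms(1), of "\<lambda>i. if i = j then 1 else 0"]) blast
  have le: "card (?F x) \<le> card (?F y)" for x y
  proof (rule card_inj_on_le)
    show "inj_on (\<lambda>z. z + (y - x) \<cdot>\<^sub>v v) (?F x)"
    proof (rule inj_onI)
      fix z z' assume "z \<in> ?F x" "z' \<in> ?F x" and eq: "z + (y - x) \<cdot>\<^sub>v v = z' + (y - x) \<cdot>\<^sub>v v"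
      then have d: "z \<in> carrier_vec l" "z' \<in> carrier_vec l" unfolding Z_def by auto
      show "z = z'"
      proof (rule eq_vecI)
        fix i assume "i < dim_vec z'"
        then show "z $ i = z' $ i"
          using arg_cong[OF eq, of "\<lambda>z. z $ i"] d v(1) by simp
      qed (use d in auto)
    qed
    show "(\<lambda>z. z + (y - x) \<cdot>\<^sub>v v) ` ?F x \<subseteq> ?F y"
      using v h \<open>j \<notin> S\<close> unfolding Z_def
      by (auto simp: scalar_prod_add_distrib[where n = l])
  qed (use fin in simp)
  have "card Z = card (\<Union>x. ?F x)" by (rule arg_cong[of _ _ card]) auto
  also have "\<dots> = (\<Sum>x\<in>UNIV. card (?F x))"
    using fin by (intro card_UN_disjoint) auto
  \<comment> \<open>The injections run both ways, so all \<open>CARD('a)\<close> fibres have the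
    same size.\<close>
  also have "\<dots> = (\<Sum>x\<in>(UNIV :: 'a set). card (?F b))"
    using le by (intro sum.cong refl antisym)
  finally show ?thesis by simp
qed

text \<open>A union bound: \<open>s\<close> positions are fixed by interpolation, and the product
  inequality says that the remaining ones cannot exclude every solution. Sets of size
  \<open>Suc s\<close> are needed because each count involves the fixed positions and one
  more.\<close>

lemma ex_avoiding:
  fixes h :: "'i \<Rightarrow> 'a :: {finite, field} vec" and w :: "'i \<Rightarrow> 'a"
  assumes "finite \<phi>" and h: "\<And>i. i \<in> \<phi> \<Longrightarrow> h i \<in> carrier_vec l"
    and "s \<le> card \<phi>" and "(card \<phi> - s) * card B < CARD('a)" and "B \<noteq> UNIV"
    and ip: "\<And>T. T \<subseteq> \<phi> \<Longrightarrow> card T \<le> Suc s \<Longrightarrow> interpolating l h T"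
  shows "\<exists>z \<in> carrier_vec l. \<forall>i\<in>\<phi>. w i + h i \<bullet> z \<notin> B"
proof -
  obtain S where S: "S \<subseteq> \<phi>" "card S = s" "finite S"
    using obtain_subset_with_card_n[OF \<open>s \<le> card \<phi>\<close>] by blast
  \<comment> \<open>One allowed value \<open>g\<close> serves for all positions of \<open>S\<close>;
    solving for \<open>h i \<bullet> z\<close> requires subtracting the offset
    \<open>w i\<close>.\<close>
  obtain g where g: "g \<notin> B" using \<open>B \<noteq> UNIV\<close> by blast
  define Z where "Z = {z \<in> carrier_vec l. \<forall>i\<in>S. h i \<bullet> z = g - w i}"
  have fin: "finite Z" unfolding Z_def by simp
  have "interpolating l h S" using S by (intro ip) auto
  then obtain z0 where "z0 \<in> carrier_vec l" "\<And>i. i \<in> S \<Longrightarrow> h i \<bullet> z0 = g - w i"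
    by (rule interpolatingE[of _ _ _ "\<lambda>i. g - w i"]) blast
  then have "Z \<noteq> {}" unfolding Z_def by blast
  then have "card Z > 0" using fin by (simp add: card_gt_0_iff)
  let ?bad = "\<lambda>i. {z \<in> Z. w i + h i \<bullet> z \<in> B}"
  have bad: "CARD('a) * card (?bad j) \<le> card B * card Z" if j: "j \<in> \<phi> - S" for j
  proof -
    have "interpolating l h (insert j S)" using S j by (intro ip) auto
    then have "CARD('a) * card {z \<in> Z. w j + h j \<bullet> z = b} = card Z" for b
      unfolding Z_def using j S h by (intro card_fiber_of_interpolating) auto
    moreover have "card (?bad j) \<le> (\<Sum>b\<in>B. card {z \<in> Z. w j + h j \<bullet> z = b})"
    proof -
      have "?bad j = (\<Union>b\<in>B. {z \<in> Z. w j + h j \<bullet> z = b})" by auto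
      then show ?thesis by (simp add: card_UN_le)
    qed
    ultimately show ?thesis
      by (metis (no_types, lifting) mult_le_mono2 sum.cong sum_constant sum_distrib_left
        of_nat_id)
  qed
  \<comment> \<open>Both sides carry the factor \<open>CARD('a)\<close>, so the estimate stays in
    the natural numbers.\<close>
  have "CARD('a) * card (\<Union>j\<in>\<phi> - S. ?bad j) \<le> CARD('a) * (\<Sum>j\<in>\<phi> - S. card (?bad j))"
    using \<open>finite \<phi>\<close> by (intro mult_le_mono2 card_UN_le) auto
  also have "\<dots> \<le> (\<Sum>j\<in>\<phi> - S. card B * card Z)"
    unfolding sum_distrib_left by (intro sum_mono bad)
  also have "\<dots> = (card \<phi> - s) * card B * card Z"
    using S by (simp add: card_Diff_subset)
  also have "\<dots> < CARD('a) * card Z"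
    using assms(4) \<open>card Z > 0\<close> by simp
  finally have "card (\<Union>j\<in>\<phi> - S. ?bad j) < card Z" by simp
  then have "\<not> Z \<subseteq> (\<Union>j\<in>\<phi> - S. ?bad j)"
    by (metis (no_types, lifting) UN_subset_iff card_mono fin finite_subset leD mem_Collect_eq subsetI)
  then obtain z where z: "z \<in> Z" "z \<notin> (\<Union>j\<in>\<phi> - S. ?bad j)" by blast
  have "w i + h i \<bullet> z \<notin> B" if "i \<in> \<phi>" for i
  proof (cases "i \<in> S")
    case True
    then show ?thesis using z(1) g unfolding Z_def by simp
  next
    case False
    then show ?thesis using z that by blast
  qed
  then show ?thesis using z(1) unfolding Z_def by blast
qed

section \<open>Minimum distance\<close>

lemma hamming_dist_le_dim: "hamming_dist x y \<le> dim_vec x"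
proof -
  have "hamming_dist x y \<le> card {..<dim_vec x}"
    unfolding hamming_dist_def by (intro card_mono) auto
  then show ?thesis by simp
qed

lemma hamming_dist_commute:
  "dim_vec x = dim_vec y \<Longrightarrow> hamming_dist x y = hamming_dist y x"
  unfolding hamming_dist_def by (metis (no_types, lifting))

lemma hamming_dist_triangle:
  assumes "dim_vec x = dim_vec y"
  shows "hamming_dist x z \<le> hamming_dist x y + hamming_dist y z"
proof -
  have "hamming_dist x z \<le> card ({i. i < dim_vec x \<and> x $ i \<noteq> y $ i} \<union> {i. i < dim_vec y \<and> y $ i \<noteq> z $ i})"
    unfolding hamming_dist_def using assms by (intro card_mono) auto
  then show ?thesis unfolding hamming_dist_def using card_Un_le le_trans by blast
qed

text \<open>All distances are at most \<open>n\<close>, so the set under \<open>Min\<close> is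
  finite and its minimum is a lower bound.\<close>

lemma min_dist_le:
  assumes "C \<subseteq> carrier_vec n" and "x \<in> C" "y \<in> C" "x \<noteq> y"
  shows "min_dist C \<le> hamming_dist x y"
  unfolding min_dist_def
proof (rule Min_le)
  have "{hamming_dist x y |x y. x \<in> C \<and> y \<in> C \<and> x \<noteq> y} \<subseteq> {..n}"
  proof clarify
    fix x y assume "x \<in> C"
    then have "dim_vec x = n" using assms(1) by auto
    then show "hamming_dist x y \<le> n" using hamming_dist_le_dim[of x y] by simp
  qed
  then show "finite {hamming_dist x y |x y. x \<in> C \<and> y \<in> C \<and> x \<noteq> y}"
    using finite_subset by blast
qed (use assms in blast)

text \<open>A nearest codeword is also within \<open>t\<close> of \<open>y\<close>, so by the
  triangle inequality it lies within \<open>2 * t\<close> of \<open>c\<close>, too close to be a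
  different codeword. This also excludes ties.\<close>

lemma nearest_codeword_unique:
  assumes C: "C \<subseteq> carrier_vec n" and "c \<in> C" and y: "y \<in> carrier_vec n"
    and "hamming_dist y c \<le> t" and "2 * t < min_dist C"
    and "is_arg_min (hamming_dist y) (\<lambda>c. c \<in> C) c'"
  shows "c' = c"
proof (rule ccontr)
  assume "c' \<noteq> c"
  have c': "c' \<in> C" "hamming_dist y c' \<le> hamming_dist y c"
    using assms(2,6) unfolding is_arg_min_linorder by auto
  have d: "dim_vec c = n" "dim_vec c' = n" "dim_vec y = n" using C c' assms(2) y by auto
  have "min_dist C \<le> hamming_dist c' c"
    using C c' \<open>c \<in> C\<close> \<open>c' \<noteq> c\<close> by (intro min_dist_le)
  also have "\<dots> \<le> hamming_dist y c' + hamming_dist y c"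
    using hamming_dist_triangle[of c' y c] hamming_dist_commute[of c' y] d by simp
  finally show False using c' assms(4,5) by linarith
qed

text \<open>A linear relation among the columns in \<open>T\<close>, extended by zeros, is a kernel
  vector of weight at most \<open>card T\<close>. Below the minimum distance only the zero vector
  qualifies.\<close>

lemma interpolating_cols_if_min_dist:
  fixes H :: "'a :: {finite, field} mat"
  assumes H: "H \<in> carrier_mat l n" and "T \<subseteq> {..<n}" and "card T < min_dist (mat_kernel H)"
  shows "interpolating l (col H) T"
proof (rule interpolating_if_independent)
  show "finite T" using assms(2) finite_subset by blast
  show "col H i \<in> carrier_vec l" if "i \<in> T" for i using H that assms(2) by auto
  fix c assume c: "\<And>k. k < l \<Longrightarrow> (\<Sum>i\<in>T. c i * col H i $ k) = 0"
  define x where "x = vec n (\<lambda>i. if i \<in> T then c i else 0)"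
  have "H *\<^sub>v x = 0\<^sub>v l"
  proof (rule eq_vecI)
    fix k assume "k < dim_vec (0\<^sub>v l :: 'a vec)"
    then have k: "k < l" by simp
    have "(H *\<^sub>v x) $ k = (\<Sum>i<n. if i \<in> T then c i * col H i $ k else 0)"
      using H k by (auto simp: scalar_prod_def x_def lessThan_atLeast0 intro!: sum.cong)
    also have "\<dots> = (\<Sum>i\<in>T. c i * col H i $ k)"
      using assms(2) by (simp add: sum.inter_restrict[symmetric] Int_absorb1)
    finally show "(H *\<^sub>v x) $ k = 0\<^sub>v l $ k" using c[OF k] k by simp
  qed (use H in auto)
  then have "x \<in> mat_kernel H" using H by (auto simp: mat_kernel_def x_def)
  \<comment> \<open>The weight of \<open>x\<close> is its distance to the zero codeword, which is
    how the minimum distance applies.\<close>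
  moreover have "0\<^sub>v n \<in> mat_kernel H" using H by (auto simp: mat_kernel_def)
  moreover have "hamming_dist x (0\<^sub>v n) \<le> card T"
    unfolding hamming_dist_def x_def using \<open>finite T\<close>
    by (intro card_mono) (auto split: if_splits)
  moreover have "mat_kernel H \<subseteq> carrier_vec n" using H by (auto simp: mat_kernel_def)
  ultimately have "x = 0\<^sub>v n" using min_dist_le assms(3) by (metis leD le_trans)
  then have "x $ i = 0" if "i < n" for i using that by simp
  then show "\<forall>i\<in>T. c i = 0" using assms(2) unfolding x_def by force
qed

section \<open>The scheme\<close>

lemma index_vec_mult_mat: "i < dim_col A \<Longrightarrow> (v \<^sub>v* A) $ i = col A i \<bullet> v"
  unfolding vec_mult_mat_def by simp

lemma dim_vec_mult_mat [simp]: "dim_vec (v \<^sub>v* A) = dim_col A"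
  unfolding vec_mult_mat_def by simp

text \<open>Presents an encoded word as a single product with the stacked generator matrix, so that
  it lies in the row space.\<close>

lemma append_vec_mult_append_rows:
  assumes "A \<in> carrier_mat r1 n" "B \<in> carrier_mat r2 n" "x \<in> carrier_vec r1" "y \<in> carrier_vec r2"
  shows "(x @\<^sub>v y) \<^sub>v* (A @\<^sub>r B) = x \<^sub>v* A + y \<^sub>v* B"
proof (rule eq_vecI)
  fix i assume "i < dim_vec (x \<^sub>v* A + y \<^sub>v* B)"
  then have i: "i < n" using assms by simp
  have "col (A @\<^sub>r B) i = col A i @\<^sub>v col B i"
    using assms i by (intro eq_vecI) (auto simp: append_rows_def)
  moreover have "dim_col (A @\<^sub>r B) = n"
    using carrier_matD(2)[OF carrier_append_rows[OF assms(1,2)]] .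
  ultimately show "((x @\<^sub>v y) \<^sub>v* (A @\<^sub>r B)) $ i = (x \<^sub>v* A + y \<^sub>v* B) $ i"
    using assms i scalar_prod_append[of "col A i" r1 "col B i" r2 x y]
    by (simp add: index_vec_mult_mat)
qed (use assms in \<open>auto simp: append_rows_def\<close>)

lemma vec_mult_mat_in_row_space:
  fixes A :: "'a :: field mat"
  assumes "A \<in> carrier_mat k n" "v \<in> carrier_vec k"
  shows "v \<^sub>v* A \<in> vec_space.row_space n A"
proof -
  interpret vec_space "TYPE('a)" n .
  show ?thesis using assms unfolding vec_mult_mat_def row_space_eq[OF assms(1)] by auto
qed

text \<open>The first \<open>l\<close> coordinates of a codeword reveal \<open>z\<close>, and the next \<open>a\<close> then reveal \<open>m\<close>.\<close>

lemma systematic_encoding_inj: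
  fixes m m' :: "'a :: comm_ring_1 vec"
  assumes A: "A \<in> carrier_mat l (a + r)" and P: "P \<in> carrier_mat a r"
    and m: "m \<in> carrier_vec a" "m' \<in> carrier_vec a"
    and z: "z \<in> carrier_vec l" "z' \<in> carrier_vec l"
  defines "G1 \<equiv> 0\<^sub>m a l @\<^sub>c 1\<^sub>m a @\<^sub>c P" and "H \<equiv> 1\<^sub>m l @\<^sub>c A"
  assumes eq: "m \<^sub>v* G1 + z \<^sub>v* H = m' \<^sub>v* G1 + z' \<^sub>v* H"
  shows "m = m'"
proof -
  have G1: "G1 \<in> carrier_mat a (l + a + r)" and H: "H \<in> carrier_mat l (l + a + r)"
    using A P unfolding G1_def H_def append_cols_def by auto
  have colG0: "col G1 i = 0\<^sub>v a" if "i < l" for i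
    using that P unfolding G1_def append_cols_def by (intro eq_vecI) auto
  have colG1: "col G1 (l + i) = unit_vec a i" if "i < a" for i
    using that P unfolding G1_def append_cols_def by (intro eq_vecI) auto
  have colH: "col H i = unit_vec l i" if "i < l" for i
    using that A unfolding H_def append_cols_def by (intro eq_vecI) auto
  have coord: "col G1 i \<bullet> m + col H i \<bullet> z = col G1 i \<bullet> m' + col H i \<bullet> z'" if "i < l + a + r" for i
    using arg_cong[OF eq, of "\<lambda>v. v $ i"] G1 H that by (simp add: index_vec_mult_mat)
  \<comment> \<open>On the first \<open>l\<close> positions \<open>G1\<close> is zero and
    \<open>H\<close> is the identity.\<close>
  have "z = z'"
  proof (rule eq_vecI)
    fix i assume "i < dim_vec z'"
    then show "z $ i = z' $ i"
      using coord[of i] colG0[of i] colH[of i] m z by simp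
  qed (use z in auto)
  \<comment> \<open>Once \<open>z = z'\<close>, the contributions of \<open>H\<close> cancel
    whatever \<open>A\<close> is, and the identity block of \<open>G1\<close>, shifted by
    \<open>l\<close>, shows the message.\<close>
  show ?thesis
  proof (rule eq_vecI)
    fix i assume "i < dim_vec m'"
    then show "m $ i = m' $ i"
      using coord[of "l + i"] colG1[of i] m \<open>z = z'\<close> by simp
  qed (use m in auto)
qed

theorem theorem4:
  fixes q n l r t u k d d0 :: nat
    and H0 G1 P :: "'a :: {finite, field} mat"
    and C0 C :: "'a vec set"
  assumes "CARD('a) = q" and "q \<ge> 3"
    and "n \<ge> 1" and "l \<ge> 1" and "n - r - l \<ge> 1"
    and "u \<le> n"
    and "(q - 1) div 2 + 1 \<le> u" and "u + 2 \<le> (q - 1) div 2 + d0"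
    and "linear_code n (n - l) d0 C0"
    and "parity_check_matrix n l H0 C0" and "systematic n l H0"
    and "k = n - r" and "linear_code n k d C" and "d \<ge> 2 * t + 1"
    and "dual_code n C0 \<subseteq> C"
    and "P \<in> carrier_mat (n - r - l) r"
    and "G1 = 0\<^sub>m (n - r - l) l @\<^sub>c 1\<^sub>m (n - r - l) @\<^sub>c P"
    and "generator_matrix n k (G1 @\<^sub>r H0) C"
  shows "(\<forall>\<phi> \<in> defect_sets n u. \<forall>m \<in> carrier_vec (n - r - l). \<exists>z. masking_vec G1 H0 \<phi> m z) \<and>
    (\<forall>E D. scheme_encoder n u G1 H0 E \<and> scheme_decoder n C G1 H0 D \<longrightarrow>
      PDMC n (q ^ (n - r - l)) u t (carrier_vec (n - r - l)) E D)"
proof -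
  let ?a = "n - r - l"
  \<comment> \<open>As \<open>n - r - l\<close> is at least 1, the truncated subtractions are exact
    and the block widths add up to \<open>n\<close>.\<close>
  have n: "n = l + ?a + r" using assms(5) by linarith
  have G1: "G1 \<in> carrier_mat ?a n"
    using assms(16,17) n unfolding append_cols_def by auto
  have H0: "H0 \<in> carrier_mat l n" and ker: "min_dist (mat_kernel H0) = d0"
    using assms(9,10) unfolding parity_check_matrix_def linear_code_def by auto
  obtain A where A: "A \<in> carrier_mat l (?a + r)" "H0 = 1\<^sub>m l @\<^sub>c A"
  proof -
    have "n - l = ?a + r" using n by linarith
    then show ?thesis using that assms(11) unfolding systematic_def by auto
  qed
  have row_space: "vec_space.row_space n (G1 @\<^sub>r H0) = C" and C_dist: "2 * t < min_dist C"
    using assms(13,14,18) unfolding generator_matrix_def linear_code_def by auto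
  have C: "C \<subseteq> carrier_vec n"
  proof -
    interpret vec_space "TYPE('a)" n .
    have "G1 @\<^sub>r H0 \<in> carrier_mat (?a + l) n" using G1 H0 by simp
    then show ?thesis using row_space row_space_eq[of "G1 @\<^sub>r H0"] by auto
  qed
  have codeword: "m \<^sub>v* G1 + z \<^sub>v* H0 \<in> C" if "m \<in> carrier_vec ?a" "z \<in> carrier_vec l" for m z
    using that G1 H0 row_space vec_mult_mat_in_row_space[of "G1 @\<^sub>r H0" "?a + l" n "m @\<^sub>v z"]
    by (simp add: append_vec_mult_append_rows)
  \<comment> \<open>Injectivity of the encoding in the message makes the \<open>THE\<close>
    description well defined.\<close>
  have message_eq: "extract_message G1 H0 (m \<^sub>v* G1 + z \<^sub>v* H0) = m"
    if "m \<in> carrier_vec ?a" "z \<in> carrier_vec l" for m z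
    unfolding extract_message_def
  proof (rule the_equality)
    fix m' assume "m' \<in> carrier_vec (dim_row G1) \<and>
      (\<exists>z'\<in>carrier_vec (dim_row H0). m \<^sub>v* G1 + z \<^sub>v* H0 = m' \<^sub>v* G1 + z' \<^sub>v* H0)"
    then obtain z' where "m' \<in> carrier_vec ?a" "z' \<in> carrier_vec l"
      "m \<^sub>v* G1 + z \<^sub>v* H0 = m' \<^sub>v* G1 + z' \<^sub>v* H0"
      using G1 H0 by auto
    then show "m' = m"
      using systematic_encoding_inj[OF A(1) assms(16) that(1) _ that(2)]
      unfolding A(2)[symmetric] assms(17)[symmetric] by metis
  qed (use that G1 H0 in auto)
  have mask: "\<exists>z. masking_vec G1 H0 \<phi> m z" if "\<phi> \<in> defect_sets n u" for \<phi> m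
  proof -
    have \<phi>: "\<phi> \<subseteq> {..<n}" "card \<phi> = u" "finite \<phi>"
      using that finite_subset unfolding defect_sets_def by auto
    have two: "card {0, -1 :: 'a} \<le> 2" by (simp add: card_insert_if)
    have "\<exists>z\<in>carrier_vec l. \<forall>i\<in>\<phi>. (m \<^sub>v* G1) $ i + col H0 i \<bullet> z \<notin> {0, -1}"
    \<comment> \<open>This \<open>s\<close> leaves exactly \<open>(q - 1) div 2\<close> positions
      with at most two forbidden values each, so the total is at most \<open>q - 1\<close>.\<close>
    proof (rule ex_avoiding[where s = "u - (q - 1) div 2"])
      have "(card \<phi> - (u - (q - 1) div 2)) * card {0, -1 :: 'a} \<le> (q - 1) div 2 * 2"
        using two \<phi>(2) assms(7) by (intro mult_le_mono) auto
      also have "\<dots> < q" using assms(2) by linarith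
      finally show "(card \<phi> - (u - (q - 1) div 2)) * card {0, -1 :: 'a} < CARD('a)"
        using assms(1) by simp
      \<comment> \<open>Here \<open>q \<ge> 3\<close> is essential: in the field of two elements 0
        and -1 are everything.\<close>
      show "{0, -1 :: 'a} \<noteq> UNIV"
      proof
        assume "{0, -1 :: 'a} = UNIV"
        then have "CARD('a) \<le> 2" using two by simp
        then show False using assms(1,2) by simp
      qed
      \<comment> \<open>The upper bound on \<open>u\<close> says \<open>s + 2 \<le> d0\<close>, so
        \<open>Suc s\<close> is still below the minimum distance.\<close>
      show "interpolating l (col H0) T" if "T \<subseteq> \<phi>" "card T \<le> Suc (u - (q - 1) div 2)" for T
        using that \<phi> ker assms(7,8)
        by (intro interpolating_cols_if_min_dist[OF H0]) auto
    qed (use \<phi> H0 in auto)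
    then obtain z where z: "z \<in> carrier_vec l"
      "\<And>i. i \<in> \<phi> \<Longrightarrow> (m \<^sub>v* G1) $ i + col H0 i \<bullet> z \<notin> {0, -1}" by blast
    have "(m \<^sub>v* G1 + z \<^sub>v* H0) $ i \<in> UNIV - {0, -1}" if "i \<in> \<phi>" for i
      using z(2)[OF that] that \<phi>(1) H0 by (auto simp: index_vec_mult_mat)
    then show ?thesis using z(1) H0 unfolding masking_vec_def by auto
  qed
  have "PDMC n (q ^ ?a) u t (carrier_vec ?a) E D"
    if E: "scheme_encoder n u G1 H0 E" and D: "scheme_decoder n C G1 H0 D" for E D
    unfolding PDMC_def
  proof (intro conjI ballI)
    show "finite (carrier_vec ?a :: 'a vec set)" by simp
    show "card (carrier_vec ?a :: 'a vec set) = q ^ ?a"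
      using assms(1) by (simp add: card_carrier_vec)
    fix \<phi> and m :: "'a vec" assume \<phi>: "\<phi> \<in> defect_sets n u" and m: "m \<in> carrier_vec ?a"
    then obtain z where z: "masking_vec G1 H0 \<phi> m z" and Em: "E \<phi> m = m \<^sub>v* G1 + z \<^sub>v* H0"
      using E G1 unfolding scheme_encoder_def by auto
    have zc: "z \<in> carrier_vec l" using z H0 unfolding masking_vec_def by auto
    have EC: "E \<phi> m \<in> C" using codeword[OF m zc] Em by simp
    then show Ec: "E \<phi> m \<in> carrier_vec n" using C by blast
    fix e :: "'a vec" assume e: "e \<in> admissible_errors n t"
    then have ec: "e \<in> carrier_vec n" and e01: "\<And>i. i < n \<Longrightarrow> e $ i \<in> {0, 1}"
      and wt: "hamming_weight e \<le> t" unfolding admissible_errors_def by auto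
    \<comment> \<open>An error entry is 0 or 1, so a zero could arise only from a stored 0 or -1,
      and masking excludes both.\<close>
    show "(E \<phi> m + e) $ i \<noteq> 0" if "i \<in> \<phi>" for i
    proof -
      have "i < n" using that \<phi> unfolding defect_sets_def by auto
      moreover have "E \<phi> m $ i \<noteq> 0" "E \<phi> m $ i \<noteq> -1"
        using z Em that unfolding masking_vec_def by auto
      ultimately show ?thesis using ec e01[of i] by (auto simp: add_eq_0_iff2)
    qed
    have "hamming_dist (E \<phi> m + e) (E \<phi> m) = hamming_weight e"
      unfolding hamming_dist_def hamming_weight_def using Ec ec
      by (intro arg_cong[of _ _ card]) auto
    with wt have close: "hamming_dist (E \<phi> m + e) (E \<phi> m) \<le> t" by simp
    obtain c where c: "is_arg_min (hamming_dist (E \<phi> m + e)) (\<lambda>c. c \<in> C) c"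
      and Dc: "D (E \<phi> m + e) = extract_message G1 H0 c"
      using D Ec ec unfolding scheme_decoder_def by (meson add_carrier_vec)
    \<comment> \<open>Whichever nearest codeword the decoder picks, at most \<open>t\<close> errors
      force it to be the stored word.\<close>
    have "c = E \<phi> m"
      using Ec ec by (intro nearest_codeword_unique[OF C EC _ close C_dist c]) simp
    then show "D (E \<phi> m + e) = m" using Dc Em message_eq[OF m zc] by simp
  qed
  with mask show ?thesis by blast
qed

end
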